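(* Let $\Gamma$ be an ordered abelian group and $\Delta$ a subgroup of $\Gamma$ of finite index. Then: (i) $\epsilon(\Gamma\mid\Delta)\leq(\Gamma:\Delta)$; and (ii) $\epsilon(\Gamma\mid\Delta)=(\Gamma:\Delta)$ if and only if $\Delta_{\geq 0}$ has finite index in $\Gamma_{\geq 0}$, i.e., if and only if there exist finitely many $\gamma_0,\ldots,\gamma_{n-1}\in\Gamma_{\geq 0}$ (with $\gamma_0=0$) such that $$\Gamma_{\geq 0}=\bigcup_{i=0}^{n-1}\left(\gamma_i+\Delta_{\geq 0}\right).$$
   Context: Ordered abelian groups are totally ordered; $\Delta$ carries the induced order. $\Gamma_{\ge0}=\{\gamma\in\Gamma\mid\gamma\ge0\}$, $\Delta_{\ge 0}=\{\delta\in\Delta\mid\delta\ge 0\}$, $\Delta_{>0}=\{\delta\in\Delta\mid\delta>0\}$. The initial index of $\Delta$ in $\Gamma$ is $\epsilon(\Gamma\mid\Delta)=|\{\gamma\in\Gamma_{\ge0}\mid\gamma<\Delta_{>0}\}|$, where $\gamma<\Delta_{>0}$ means $\gamma<\delta$ for all $\delta\in\Delta_{>0}$. *)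

theory Defs
  imports "HOL-Library.Extended_Nat" "HOL-Library.Set_Algebras"
begin

text \<open>
  An ordered abelian group \<open>\<Gamma>\<close> is a type of class \<^class>\<open>linordered_ab_group_add\<close>
  (the order is total); a subgroup \<open>\<Delta>\<close> is a set of its elements, with the induced order.
\<close>

definition add_subgroup :: "'a::ab_group_add set \<Rightarrow> bool"
  where "add_subgroup D \<longleftrightarrow>
    0 \<in> D \<and> (\<forall>x\<in>D. \<forall>y\<in>D. x + y \<in> D) \<and> (\<forall>x\<in>D. - x \<in> D)"

text \<open>
  Cardinality with a value \<open>\<infinity>\<close> for all infinite sets, in place of \<^const>\<open>card\<close>,
  which is \<open>0\<close> on them.
\<close>

definition ecard :: "'a set \<Rightarrow> enat"
  where "ecard A = (if finite A then enat (card A) else \<infinity>)"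

definition add_index :: "'a::ab_group_add set \<Rightarrow> enat"
  where "add_index D = ecard (range (\<lambda>g. g +o D))"

definition nonneg_part :: "'a::linordered_ab_group_add set \<Rightarrow> 'a set"
  where "nonneg_part D = {d \<in> D. 0 \<le> d}"

definition pos_part :: "'a::linordered_ab_group_add set \<Rightarrow> 'a set"
  where "pos_part D = {d \<in> D. 0 < d}"

definition initial_index :: "'a::linordered_ab_group_add set \<Rightarrow> enat"
  where "initial_index D = ecard {g \<in> nonneg_part UNIV. \<forall>d \<in> pos_part D. g < d}"

end

theory Submission
  imports Defs
begin

text \<open>
  Let \<open>I\<close> be the set counted by the initial index. Two elements of \<open>I\<close> differ by less than every
  positive element of \<open>\<Delta>\<close>, so \<open>I\<close> embeds into the cosets of \<open>\<Delta>\<close>, and equality in (i) means that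
  \<open>I\<close> meets every coset. An element of \<open>I\<close> is the least nonnegative element of its coset, so if
  \<open>I\<close> meets every coset, its translates of \<open>\<Delta>\<^sub>\<ge>\<^sub>0\<close> cover \<open>\<Gamma>\<^sub>\<ge>\<^sub>0\<close>. Conversely, every coset has
  nonnegative elements because \<open>\<Delta>\<close> is cofinal in \<open>\<Gamma>\<close>, and given a finite cover their minimum exists:
  it is the least of the \<open>\<gamma>\<^sub>i\<close> in the coset, and it lies in \<open>I\<close>.
\<close>

lemma add_subgroup_diff:
  assumes "add_subgroup D" "x \<in> D" "y \<in> D"
  shows "x - y \<in> D"
  using assms unfolding add_subgroup_def by (metis diff_conv_add_uminus)

lemma add_subgroup_coset_eq_iff:
  fixes D :: "'a::ab_group_add set"
  assumes D: "add_subgroup D"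
  shows "x +o D = y +o D \<longleftrightarrow> x - y \<in> D"
proof
  assume eq: "x +o D = y +o D"
  have "x \<in> x +o D"
    using D unfolding elt_set_plus_def add_subgroup_def by force
  then show "x - y \<in> D"
    unfolding eq by (auto simp: elt_set_plus_def)
next
  have sub: "x +o D \<subseteq> y +o D" if "x - y \<in> D" for x y :: 'a
  proof
    fix z assume "z \<in> x +o D"
    then obtain d where d: "d \<in> D" "z = x + d"
      by (auto simp: elt_set_plus_def)
    have "x - y + d \<in> D"
      using D that d unfolding add_subgroup_def by blast
    moreover have "z = y + (x - y + d)"
      using d by (simp add: algebra_simps)
    ultimately show "z \<in> y +o D"
      unfolding elt_set_plus_def by blast
  qed
  assume "x - y \<in> D"
  moreover from this have "y - x \<in> D"
    using D unfolding add_subgroup_def by (metis minus_diff_eq)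
  ultimately show "x +o D = y +o D"
    using sub by blast
qed

text \<open>By pigeonhole two distinct multiples of \<open>a\<close> lie in the same coset. Their
  difference is a nonzero multiple of \<open>a\<close> in \<open>D\<close>, which for
  \<open>a > 0\<close> can be taken positive and is then at least \<open>a\<close>.\<close>

lemma finite_index_cofinal:
  fixes D :: "'a::linordered_ab_group_add set"
  assumes D: "add_subgroup D" and fin: "finite (range (\<lambda>g. g +o D))"
  obtains d where "d \<in> D" "a \<le> d"
proof (cases "a \<le> 0")
  case True
  then show ?thesis
    using D that unfolding add_subgroup_def by blast
next
  case False
  \<comment> \<open>The \<open>k\<close>-fold multiple of \<open>a\<close>, written as a constant
    sum so that a difference of multiples is a sum over an interval.\<close>
  define m where "m k = (\<Sum>i<k. a)" for k :: nat
  have "finite (range (\<lambda>k. m k +o D))"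
    by (rule finite_subset[OF _ fin]) auto
  then have "\<not> inj (\<lambda>k. m k +o D)"
    using finite_imageD infinite_UNIV_nat by blast
  then obtain i j where "i < j" and eq: "m j +o D = m i +o D"
    unfolding inj_def by (metis nat_neq_iff)
  have "m j = m i + (\<Sum>k\<in>{i..<j}. a)"
    unfolding m_def lessThan_atLeast0 using \<open>i < j\<close>
    by (simp add: sum.atLeastLessThan_concat)
  then have "(\<Sum>k\<in>{i..<j}. a) \<in> D"
    using eq D by (simp add: add_subgroup_coset_eq_iff)
  moreover have "a \<le> (\<Sum>k\<in>{i..<j}. a)"
    using sum_mono2[of "{i..<j}" "{i}" "\<lambda>_. a"] \<open>i < j\<close> False by simp
  ultimately show ?thesis
    by (rule that)
qed

text \<open>The set \<open>I\<close> of the overview, whose \<open>ecard\<close> is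
  \<open>initial_index D\<close>.\<close>

definition initial_segment :: "'a::linordered_ab_group_add set \<Rightarrow> 'a set"
  where "initial_segment D = {g \<in> nonneg_part UNIV. \<forall>d \<in> pos_part D. g < d}"

text \<open>If \<open>x < g\<close>, then \<open>g - x\<close> is a positive element of
  \<open>D\<close>, hence exceeds \<open>g\<close>, which forces \<open>x < 0\<close>.\<close>

lemma initial_segment_least:
  fixes D :: "'a::linordered_ab_group_add set"
  assumes D: "add_subgroup D" and g: "g \<in> initial_segment D"
    and "0 \<le> x" "x - g \<in> D"
  shows "g \<le> x"
proof (rule ccontr)
  assume "\<not> g \<le> x"
  moreover have "g - x \<in> D"
    using D assms(4) unfolding add_subgroup_def by (metis minus_diff_eq)
  ultimately have "g - x \<in> pos_part D"
    by (simp add: pos_part_def)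
  then have "g < g - x"
    using g by (auto simp: initial_segment_def)
  then show False
    using \<open>0 \<le> x\<close> by (simp add: less_diff_eq)
qed

text \<open>Two elements of \<open>I\<close> in one coset are both its least nonnegative
  element.\<close>

lemma inj_on_initial_segment:
  fixes D :: "'a::linordered_ab_group_add set"
  assumes D: "add_subgroup D"
  shows "inj_on (\<lambda>g. g +o D) (initial_segment D)"
proof (rule inj_onI)
  fix x y assume xy: "x \<in> initial_segment D" "y \<in> initial_segment D" "x +o D = y +o D"
  then have "x - y \<in> D" "y - x \<in> D"
    using D add_subgroup_coset_eq_iff by metis+
  moreover have "0 \<le> x" "0 \<le> y"
    using xy by (auto simp: initial_segment_def nonneg_part_def)
  ultimately show "x = y"
    using xy initial_segment_least[OF D] by (meson order_antisym)
qed

lemma initial_segment_cover: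
  fixes D :: "'a::linordered_ab_group_add set"
  assumes D: "add_subgroup D"
    and surj: "(\<lambda>g. g +o D) ` initial_segment D = range (\<lambda>g. g +o D)"
  shows "nonneg_part UNIV = (\<Union>g\<in>initial_segment D. g +o nonneg_part D)"
proof
  show "(\<Union>g\<in>initial_segment D. g +o nonneg_part D) \<subseteq> nonneg_part UNIV"
    by (auto simp: initial_segment_def nonneg_part_def elt_set_plus_def)
  show "nonneg_part UNIV \<subseteq> (\<Union>g\<in>initial_segment D. g +o nonneg_part D)"
  proof
    fix x :: 'a assume "x \<in> nonneg_part UNIV"
    then have x: "0 \<le> x"
      by (simp add: nonneg_part_def)
    obtain g where g: "g \<in> initial_segment D" and "x +o D = g +o D"
      using surj by (metis imageE rangeI)
    then have xg: "x - g \<in> D"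
      using D by (simp add: add_subgroup_coset_eq_iff)
    then have "x - g \<in> nonneg_part D"
      using initial_segment_least[OF D g x] by (simp add: nonneg_part_def)
    then have "x \<in> g +o nonneg_part D"
      unfolding elt_set_plus_def by force
    then show "x \<in> (\<Union>g\<in>initial_segment D. g +o nonneg_part D)"
      using g by blast
  qed
qed

text \<open>Finite index provides a nonnegative element in each coset; finiteness of
  \<open>S\<close> provides the least one.\<close>

lemma finite_cover_imp_initial_segment_surj:
  fixes D :: "'a::linordered_ab_group_add set"
  assumes D: "add_subgroup D" and fin: "finite (range (\<lambda>g. g +o D))"
    and "finite S" and S: "S \<subseteq> nonneg_part UNIV"
    and cover: "nonneg_part UNIV = (\<Union>s\<in>S. s +o nonneg_part D)"
  shows "(\<lambda>g. g +o D) ` initial_segment D = range (\<lambda>g. g +o D)"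
proof
  show "range (\<lambda>g. g +o D) \<subseteq> (\<lambda>g. g +o D) ` initial_segment D"
  proof
    fix C assume "C \<in> range (\<lambda>g. g +o D)"
    then obtain g where C: "C = g +o D"
      by blast
    define T where "T = {s \<in> S. s - g \<in> D}"
    have "finite T"
      using \<open>finite S\<close> by (simp add: T_def)
    \<comment> \<open>Writing \<open>x = s + d\<close> with \<open>d\<close> in \<open>D\<close> and
      \<open>d \<ge> 0\<close> puts \<open>s\<close> in the coset of \<open>x\<close> and at or
      below \<open>x\<close>. So \<open>T\<close> bounds the nonnegative elements of the coset of
      \<open>g\<close> from below.\<close>
    have below: "\<exists>t\<in>T. t \<le> x" if x: "0 \<le> x" "x - g \<in> D" for x
    proof -
      obtain s d where s: "s \<in> S" "d \<in> D" "0 \<le> d" "x = s + d"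
        using x cover by (fastforce simp: nonneg_part_def elt_set_plus_def)
      then have "s - g = (x - g) - d"
        by simp
      then have "s - g \<in> D"
        using add_subgroup_diff[OF D] x s by metis
      then show ?thesis
        using s by (auto simp: T_def)
    qed
    obtain d where "d \<in> D" "- g \<le> d"
      using finite_index_cofinal[OF D fin] .
    then have "0 \<le> g + d"
      using add_left_mono[of "- g" d g] by simp
    then have "T \<noteq> {}"
      using below[of "g + d"] \<open>d \<in> D\<close> by auto
    define c where "c = Min T"
    have c: "c \<in> T"
      using \<open>finite T\<close> \<open>T \<noteq> {}\<close> by (simp add: c_def)
    \<comment> \<open>Otherwise \<open>c - e\<close> is a nonnegative element of the same coset, so
      some \<open>t\<close> in \<open>T\<close> lies at or below it, hence strictly below the
      minimum \<open>c\<close>.\<close>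
    have "c < e" if "e \<in> pos_part D" for e
    proof (rule ccontr)
      assume "\<not> c < e"
      then have "0 \<le> c - e"
        by simp
      have e: "e \<in> D" "0 < e"
        using that by (auto simp: pos_part_def)
      have "(c - e) - g \<in> D"
        using add_subgroup_diff[OF D, of "c - g" e] c e by (simp add: T_def algebra_simps)
      then obtain t where "t \<in> T" "t \<le> c - e"
        using below[OF \<open>0 \<le> c - e\<close>] by blast
      moreover from this have "c \<le> t"
        using \<open>finite T\<close> by (simp add: c_def)
      ultimately have "c \<le> c - e"
        by order
      then show False
        using \<open>0 < e\<close> by simp
    qed
    then have "c \<in> initial_segment D"
      using c S by (auto simp: initial_segment_def T_def)
    moreover have "C = c +o D"
      using c C D by (simp add: T_def flip: add_subgroup_coset_eq_iff)
    ultimately show "C \<in> (\<lambda>g. g +o D) ` initial_segment D"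
      by blast
  qed
qed blast

theorem proposition3p3:
  fixes \<Delta> :: "'a::linordered_ab_group_add set"
  assumes "add_subgroup \<Delta>"
    and "add_index \<Delta> < \<infinity>"
  shows "initial_index \<Delta> \<le> add_index \<Delta> \<and>
    (initial_index \<Delta> = add_index \<Delta> \<longleftrightarrow>
      (\<exists>(n::nat) (\<gamma> :: nat \<Rightarrow> 'a). 0 < n \<and> \<gamma> 0 = 0 \<and>
        (\<forall>i<n. \<gamma> i \<in> nonneg_part UNIV) \<and>
        nonneg_part UNIV = (\<Union>i<n. \<gamma> i +o nonneg_part \<Delta>)))"
    (is "_ \<and> (_ \<longleftrightarrow> ?cover)")
proof -
  note D = assms(1)
  let ?I = "initial_segment \<Delta>" and ?f = "\<lambda>g. g +o \<Delta>"
  have fin: "finite (range ?f)"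
    using assms(2) by (simp add: add_index_def ecard_def split: if_splits)
  have sub: "?f ` ?I \<subseteq> range ?f"
    by blast
  have finI: "finite ?I"
    using inj_on_initial_segment[OF D] finite_subset[OF sub fin] finite_imageD by blast
  have cardI: "card (?f ` ?I) = card ?I"
    using inj_on_initial_segment[OF D] by (rule card_image)
  have initial: "initial_index \<Delta> = enat (card (?f ` ?I))"
    using finI cardI by (simp add: initial_index_def ecard_def flip: initial_segment_def)
  have index: "add_index \<Delta> = enat (card (range ?f))"
    using fin by (simp add: add_index_def ecard_def)
  \<comment> \<open>For a subset of a finite set, equal cardinality means equality, so (ii) becomes
    a statement about \<open>I\<close> meeting every coset.\<close>
  have eq_iff: "initial_index \<Delta> = add_index \<Delta> \<longleftrightarrow> ?f ` ?I = range ?f"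
    unfolding initial index using card_subset_eq[OF fin sub] by auto
  have "?cover" if surj: "?f ` ?I = range ?f"
  proof -
    obtain h where "bij_betw h {0..<card ?I} ?I"
      using ex_bij_betw_nat_finite[OF finI] by blast
    then have h: "h ` {..<card ?I} = ?I"
      by (simp add: bij_betw_def lessThan_atLeast0)
    \<comment> \<open>The enumeration \<open>h\<close> need not start at 0, so 0 is put in front. As
      0 already lies in \<open>I\<close>, the image stays \<open>I\<close>; one value is repeated,
      and the length is \<open>Suc (card ?I)\<close>.\<close>
    define \<gamma> where "\<gamma> = case_nat 0 h"
    have "0 \<in> ?I"
      by (auto simp: initial_segment_def nonneg_part_def pos_part_def)
    then have img: "\<gamma> ` {..<Suc (card ?I)} = ?I"
      using h by (auto simp: \<gamma>_def lessThan_Suc_eq_insert_0 image_image)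
    have "(\<Union>i<Suc (card ?I). \<gamma> i +o nonneg_part \<Delta>)
        = (\<Union>g\<in>\<gamma> ` {..<Suc (card ?I)}. g +o nonneg_part \<Delta>)"
      by blast
    also have "\<dots> = nonneg_part UNIV"
      unfolding img by (rule initial_segment_cover[OF D surj, symmetric])
    finally have "nonneg_part UNIV = (\<Union>i<Suc (card ?I). \<gamma> i +o nonneg_part \<Delta>)"
      by (rule sym)
    moreover have "\<forall>i<Suc (card ?I). \<gamma> i \<in> nonneg_part UNIV"
      using img by (auto simp: initial_segment_def)
    moreover have "\<gamma> 0 = 0"
      by (simp add: \<gamma>_def)
    ultimately show ?cover
      by (intro exI[of _ "Suc (card ?I)"] exI[of _ \<gamma>]) simp
  qed
  moreover have "?f ` ?I = range ?f" if ?cover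
  proof -
    from that obtain n and \<gamma> :: "nat \<Rightarrow> 'a" where "\<forall>i<n. \<gamma> i \<in> nonneg_part UNIV"
      and "nonneg_part UNIV = (\<Union>i<n. \<gamma> i +o nonneg_part \<Delta>)"
      by blast
    then show ?thesis
      by (intro finite_cover_imp_initial_segment_surj[OF D fin, of "\<gamma> ` {..<n}"]) auto
  qed
  moreover have "initial_index \<Delta> \<le> add_index \<Delta>"
    unfolding initial index using card_mono[OF fin sub] by simp
  ultimately show ?thesis
    unfolding eq_iff by blast
qed

end
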